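(* Let $Y$ be a real topological vector space and $F, D\subseteq Y$. (a) $F\setminus\operatorname{core}(F+D)\subseteq\operatorname{WEff}(F,D)$. (b) If $D$ is a non-trivial convex cone with nonempty interior, then $\operatorname{WEff}(F,D)=F\setminus\operatorname{core}(F+D)$.
   Context: For $F,D\subseteq Y$: $\operatorname{Eff}(F,D):=\{y^0\in F\mid F\cap(y^0-D)\subseteq\{y^0\}\}$ (efficient elements of $F$ w.r.t. $D$) and $\operatorname{WEff}(F,D):=\operatorname{Eff}(F,\operatorname{int}D)$ (weakly efficient elements). $\operatorname{core}A$ denotes the algebraic interior of $A$. A set $C\subseteq Y$ is a cone if $\mathbb{R}_+C\subseteq C$ with $\mathbb{R}_+=\{x\in\mathbb{R}\mid x\ge 0\}$; it is non-trivial if $C\neq\emptyset$, $C\neq\{0\}$ and $C\neq Y$. *)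

theory Defs
  imports "HOL-Analysis.Analysis"
begin

text \<open>Real topological vector spaces; no separation axiom is assumed.\<close>

class topological_real_vector = topological_ab_group_add + real_vector +
  assumes tendsto_scaleR_Pair:
    "LIM x (nhds c \<times>\<^sub>F nhds a). fst x *\<^sub>R snd x :> nhds (c *\<^sub>R a)"

instance real_normed_vector \<subseteq> topological_real_vector
proof
  fix c :: real and a :: 'a
  show "LIM x (nhds c \<times>\<^sub>F nhds a). fst x *\<^sub>R snd x :> nhds (c *\<^sub>R a)"
    by (intro tendsto_scaleR filterlim_fst filterlim_snd)
qed

definition core :: "'a::real_vector set \<Rightarrow> 'a set" where
  "core A = {a \<in> A. \<forall>v. \<exists>\<epsilon>>0. \<forall>t\<in>{0..\<epsilon>}. a + t *\<^sub>R v \<in> A}"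

text \<open>
  The difference \<open>y\<^sub>0 - D\<close> is written as an image, because \<open>-\<close> on sets is set difference.
\<close>

definition Eff :: "'a::ab_group_add set \<Rightarrow> 'a set \<Rightarrow> 'a set" where
  "Eff F D = {y\<^sub>0 \<in> F. F \<inter> (\<lambda>d. y\<^sub>0 - d) ` D \<subseteq> {y\<^sub>0}}"

definition WEff :: "'a::topological_real_vector set \<Rightarrow> 'a set \<Rightarrow> 'a set" where
  "WEff F D = Eff F (interior D)"

definition nontrivial_cone :: "'a::real_vector set \<Rightarrow> bool" where
  "nontrivial_cone C \<longleftrightarrow> cone C \<and> C \<noteq> {} \<and> C \<noteq> {0} \<and> C \<noteq> UNIV"

end

theory Submission
  imports Defs
begin

text \<open>
  Both inclusions compare the algebraic interior of \<open>F + D\<close> with \<open>F + interior D\<close>.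
  A point \<open>y\<close> of \<open>F\<close> is not weakly efficient exactly if \<open>y = f + d\<close> with \<open>f \<in> F\<close> and
  \<open>d \<in> interior D\<close>, \<open>d \<noteq> 0\<close>.

  For (a): continuity of the vector space operations makes every interior point of \<open>D\<close> an
  algebraically interior one, and translation by \<open>f \<in> F\<close> carries \<open>core D\<close> into \<open>core (F + D)\<close>,
  so such a \<open>y\<close> lies in \<open>core (F + D)\<close>.

  For (b): let \<open>y \<in> core (F + D)\<close> and choose \<open>k \<in> interior D\<close>. Moving from \<open>y\<close> a little in the
  direction \<open>-k\<close> stays in \<open>F + D\<close>, say \<open>y - \<epsilon> k = f + d\<close>, and then \<open>y = f + (d + \<epsilon> k)\<close>,
  where \<open>d + \<epsilon> k\<close> is interior to \<open>D\<close> because \<open>D\<close> is a convex cone. This vector is not \<open>0\<close>,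
  since a cone that is a neighbourhood of \<open>0\<close> absorbs, hence contains, everything.
\<close>

lemma tendsto_scaleR_topological:
  fixes a :: "'a::topological_real_vector"
  assumes "(f \<longlongrightarrow> c) G" "(g \<longlongrightarrow> a) G"
  shows "((\<lambda>x. f x *\<^sub>R g x) \<longlongrightarrow> c *\<^sub>R a) G"
  using filterlim_compose[OF tendsto_scaleR_Pair filterlim_Pair[OF assms]] by simp

lemma interior_subset_core:
  fixes A :: "'a::topological_real_vector set"
  shows "interior A \<subseteq> core A"
proof
  fix a assume a: "a \<in> interior A"
  have "\<exists>\<epsilon>>0. \<forall>t\<in>{0..\<epsilon>}. a + t *\<^sub>R v \<in> A" for v
  proof -
    have "((\<lambda>t. a + t *\<^sub>R v) \<longlongrightarrow> a + 0 *\<^sub>R v) (nhds (0::real))"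
      by (intro tendsto_add tendsto_scaleR_topological tendsto_const) (simp add: filterlim_ident)
    then have "\<forall>\<^sub>F t in nhds (0::real). a + t *\<^sub>R v \<in> interior A"
      using a by (auto dest: topological_tendstoD[OF _ open_interior])
    then obtain \<delta> where "\<delta> > 0" and \<delta>: "\<And>t. dist t 0 < \<delta> \<Longrightarrow> a + t *\<^sub>R v \<in> interior A"
      unfolding eventually_nhds_metric by blast
    then have "\<forall>t\<in>{0..\<delta> / 2}. a + t *\<^sub>R v \<in> A"
      using interior_subset[of A] by (auto simp: dist_real_def subset_iff)
    with \<open>\<delta> > 0\<close> show ?thesis
      by (intro exI[of _ "\<delta> / 2"]) simp
  qed
  then show "a \<in> core A"
    using a interior_subset by (auto simp: core_def)
qed

lemma add_core_subset_core_add: "F + core D \<subseteq> core (F + D)"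
proof
  fix y assume "y \<in> F + core D"
  then obtain f d where y: "y = f + d" and f: "f \<in> F" and d: "d \<in> core D"
    by (elim set_plus_elim)
  have "\<exists>\<epsilon>>0. \<forall>t\<in>{0..\<epsilon>}. y + t *\<^sub>R v \<in> F + D" for v
  proof -
    obtain \<epsilon> where "\<epsilon> > 0" and "\<And>t. t \<in> {0..\<epsilon>} \<Longrightarrow> d + t *\<^sub>R v \<in> D"
      using d unfolding core_def by blast
    then show ?thesis
      using f by (intro exI[of _ \<epsilon>]) (auto simp: y add.assoc)
  qed
  then show "y \<in> core (F + D)"
    using f d by (auto simp: core_def y)
qed

lemma cone_eq_UNIV_if_0_in_core:
  assumes "cone C" and "0 \<in> core C"
  shows "C = UNIV"
proof -
  have "v \<in> C" for v
  proof -
    obtain \<epsilon> where "\<epsilon> > 0" and "\<forall>t\<in>{0..\<epsilon>}. 0 + t *\<^sub>R v \<in> C"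
      using assms(2) unfolding core_def by blast
    then have \<epsilon>: "\<epsilon> > 0" "\<epsilon> *\<^sub>R v \<in> C"
      by simp_all
    have "(1 / \<epsilon>) *\<^sub>R \<epsilon> *\<^sub>R v \<in> C"
      by (rule mem_cone[OF assms(1) \<epsilon>(2)]) (use \<epsilon>(1) in simp)
    moreover have "(1 / \<epsilon>) *\<^sub>R \<epsilon> *\<^sub>R v = v"
      using \<epsilon>(1) by simp
    ultimately show ?thesis by (simp only:)
  qed
  then show ?thesis by blast
qed

text \<open>
  The affine homeomorphism \<open>x \<mapsto> d + \<epsilon> x\<close> maps the convex cone into itself, so it maps interior
  points to interior points; openness of the image of the interior is continuity of the inverse
  map \<open>x \<mapsto> (x - d) / \<epsilon>\<close>.
\<close>

lemma convex_cone_add_scaleR_interior: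
  fixes D :: "'a::topological_real_vector set"
  assumes "cone D" "convex D" and d: "d \<in> D" and k: "k \<in> interior D" and "\<epsilon> > 0"
  shows "d + \<epsilon> *\<^sub>R k \<in> interior D"
proof (rule interiorI)
  let ?g = "\<lambda>x. (1 / \<epsilon>) *\<^sub>R (x - d)"
  have "continuous_on UNIV ?g"
    unfolding continuous_on_def
    by (intro ballI tendsto_scaleR_topological tendsto_diff tendsto_const tendsto_ident_at)
  then show "open (?g -` interior D)"
    by (rule open_vimage[OF open_interior])
  show "d + \<epsilon> *\<^sub>R k \<in> ?g -` interior D"
    using k \<open>\<epsilon> > 0\<close> by simp
  show "?g -` interior D \<subseteq> D"
  proof
    fix x assume "x \<in> ?g -` interior D"
    then have "?g x \<in> D"
      using interior_subset by auto
    then have "\<epsilon> *\<^sub>R ?g x \<in> D"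
      by (rule mem_cone[OF \<open>cone D\<close>]) (use \<open>\<epsilon> > 0\<close> in simp)
    then have "d + \<epsilon> *\<^sub>R ?g x \<in> D"
      using convex_cone[of D] \<open>cone D\<close> \<open>convex D\<close> d by blast
    moreover have "d + \<epsilon> *\<^sub>R ?g x = x"
      using \<open>\<epsilon> > 0\<close> by simp
    ultimately show "x \<in> D" by (simp only:)
  qed
qed

lemma core_add_convex_cone_subset:
  fixes F D :: "'a::topological_real_vector set"
  assumes "cone D" "convex D" "interior D \<noteq> {}"
  shows "core (F + D) \<subseteq> F + interior D"
proof
  fix y assume y: "y \<in> core (F + D)"
  obtain k where k: "k \<in> interior D"
    using assms(3) by blast
  obtain \<epsilon> where "\<epsilon> > 0" and "\<forall>t\<in>{0..\<epsilon>}. y + t *\<^sub>R (- k) \<in> F + D"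
    using y unfolding core_def by blast
  then have "y + \<epsilon> *\<^sub>R (- k) \<in> F + D"
    by simp
  then obtain f d where f: "f \<in> F" and d: "d \<in> D" and "y + \<epsilon> *\<^sub>R (- k) = f + d"
    by (elim set_plus_elim)
  then have "y = f + (d + \<epsilon> *\<^sub>R k)"
    by (simp add: algebra_simps)
  then show "y \<in> F + interior D"
    using f convex_cone_add_scaleR_interior[OF assms(1,2) d k \<open>\<epsilon> > 0\<close>] by auto
qed

lemma Eff_iff_not_add:
  "y \<in> Eff F D \<longleftrightarrow> y \<in> F \<and> y \<notin> F + (D - {0})"
proof -
  have "(\<exists>d\<in>D. d \<noteq> 0 \<and> y - d \<in> F) \<longleftrightarrow> y \<in> F + (D - {0})"
  proof
    assume "\<exists>d\<in>D. d \<noteq> 0 \<and> y - d \<in> F"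
    then obtain d where "d \<in> D - {0}" "y - d \<in> F" by blast
    then show "y \<in> F + (D - {0})"
      using set_plus_intro[of "y - d" F d "D - {0}"] by simp
  next
    assume "y \<in> F + (D - {0})"
    then obtain f d where "y = f + d" "f \<in> F" "d \<in> D - {0}"
      by (rule set_plus_elim)
    then show "\<exists>d\<in>D. d \<noteq> 0 \<and> y - d \<in> F"
      by (intro bexI[of _ d]) auto
  qed
  moreover have "y \<in> Eff F D \<longleftrightarrow> y \<in> F \<and> \<not> (\<exists>d\<in>D. d \<noteq> 0 \<and> y - d \<in> F)"
    by (auto simp: Eff_def)
  ultimately show ?thesis by simp
qed

theorem theorem3:
  fixes F D :: "'a::topological_real_vector set"
  shows "F - core (F + D) \<subseteq> WEff F D \<and>
    (nontrivial_cone D \<and> convex D \<and> interior D \<noteq> {} \<longrightarrow>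
      WEff F D = F - core (F + D))"
proof -
  have "F + (interior D - {0}) \<subseteq> F + core D"
    using interior_subset_core by (intro set_plus_mono2) auto
  then have "F + (interior D - {0}) \<subseteq> core (F + D)"
    using add_core_subset_core_add by blast
  then have a: "F - core (F + D) \<subseteq> WEff F D"
    by (auto simp: WEff_def Eff_iff_not_add)
  have "WEff F D \<subseteq> F - core (F + D)"
    if D: "nontrivial_cone D" "convex D" "interior D \<noteq> {}"
  proof -
    have "cone D" "D \<noteq> UNIV"
      using D(1) by (auto simp: nontrivial_cone_def)
    then have "0 \<notin> interior D"
      using cone_eq_UNIV_if_0_in_core interior_subset_core by blast
    then have "core (F + D) \<subseteq> F + (interior D - {0})"
      using core_add_convex_cone_subset[OF \<open>cone D\<close> D(2,3)] by simp
    then show ?thesis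
      by (auto simp: WEff_def Eff_iff_not_add)
  qed
  with a show ?thesis by blast
qed

end
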